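(* For fixed $k\ge1$, the sequence of Narayana numbers $(N(n,k))_{n\ge0}$ is log-concave, i.e. $N(n,k)^2\ge N(n-1,k)\,N(n+1,k)$ for all $n\ge1$.
   Context: For $1\le k\le n$ the Narayana number is $N(n,k)=\frac1n\binom{n}{k-1}\binom nk$; for $0\le n<k$ we set $N(n,k)=0$. Equivalently, $N(n,k)$ is the number of non-crossing set partitions of $\{1,\ldots,n\}$ with $k$ blocks, where a partition is crossing if there are $a<b<c<d$ with $a,c$ in one block and $b,d$ in a different block, and non-crossing otherwise. *)

theory Defs
  imports Complex_Main
begin

text \<open>
  The values are taken in the reals so that the division by \<open>n\<close> is the exact one.
  Only \<open>k \<ge> 1\<close> is meaningful; the value \<open>0\<close> at \<open>k = 0\<close> is a mere totalisation.
\<close>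

definition narayana :: "nat \<Rightarrow> nat \<Rightarrow> real" where
  "narayana n k =
     (if 1 \<le> k \<and> k \<le> n
      then 1 / real n * real (n choose (k - 1)) * real (n choose k)
      else 0)"

definition log_concave :: "(nat \<Rightarrow> real) \<Rightarrow> bool" where
  "log_concave a \<longleftrightarrow> (\<forall>n\<ge>1. (a n)\<^sup>2 \<ge> a (n - 1) * a (n + 1))"

end

theory Submission
  imports Defs
begin

text \<open>
  By the absorption identity \<open>k \<cdot> C(n,k) = n \<cdot> C(n-1,k-1)\<close> the division by \<open>n\<close> disappears:
  \<open>N(n,k) = C(n,k-1) \<cdot> C(n-1,k-1) / k\<close> for \<open>n \<ge> 1\<close>. For fixed \<open>k\<close> this is a constant times
  two shifts of the single sequence \<open>n \<mapsto> C(n,j)\<close> with \<open>j = k-1\<close>, and a product of nonnegative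
  log-concave sequences is log-concave. So everything rests on the log-concavity of binomial
  coefficients in the upper index (\<open>binomial_log_concave_upper\<close>), which holds because the ratio
  \<open>C(n+1,j) / C(n,j) = (n+1) / (n+1-j)\<close> does not increase as \<open>n \<ge> j\<close> grows. Only \<open>n = 1\<close> falls
  outside the product formula, and there the left neighbour \<open>N(0,k)\<close> vanishes.
\<close>

text \<open>
  Comparing consecutive ratios \<open>C(m+2,j)/C(m+1,j)\<close> and \<open>C(m+1,j)/C(m,j)\<close> amounts, with
  \<open>d = m+1-j\<close>, to \<open>d(m+2) \<le> (d+1)(m+1)\<close>, that is, to \<open>d \<le> m+1\<close>.
\<close>

lemma binomial_log_concave_upper:
  "(m choose j) * (Suc (Suc m) choose j) \<le> (Suc m choose j)\<^sup>2"
proof (cases "j \<le> Suc m")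
  case True
  define d where "d = Suc m - j"
  let ?A = "m choose j" and ?B = "Suc m choose j" and ?C = "Suc (Suc m) choose j"
  have A: "Suc m * ?A = d * ?B"
    using binomial_absorb_comp[of "Suc m" j] by (simp add: d_def)
  have C: "Suc d * ?C = Suc (Suc m) * ?B"
    using binomial_absorb_comp[of "Suc (Suc m)" j] True by (simp add: d_def Suc_diff_le)
  have "(Suc m * Suc d) * (?A * ?C) = (Suc m * ?A) * (Suc d * ?C)"
    by (simp only: ac_simps)
  also have "\<dots> = (d * Suc (Suc m)) * ?B\<^sup>2"
    unfolding A C by (simp only: power2_eq_square ac_simps)
  also have "\<dots> \<le> (Suc m * Suc d) * ?B\<^sup>2"
  proof (rule mult_right_mono)
    have "d \<le> Suc m" by (simp add: d_def)
    then show "d * Suc (Suc m) \<le> Suc m * Suc d" by (simp add: algebra_simps)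
  qed simp
  finally show ?thesis
    by (metis mult_le_cancel1 nat_0_less_mult_iff zero_less_Suc)
qed (simp add: binomial_eq_0)

text \<open>
  Both sides vanish for \<open>n < j\<close>, so the product form needs no case distinction on the
  support of the sequence.
\<close>

lemma narayana_eq_binomial_product:
  "narayana (Suc n) (Suc j) = real (Suc n choose j) * real (n choose j) / real (Suc j)"
proof (cases "j \<le> n")
  case True
  have "real (Suc j) * real (Suc n choose Suc j) = real (Suc n) * real (n choose j)"
    by (metis Suc_times_binomial of_nat_mult)
  then have "real (Suc n choose Suc j) = real (Suc n) * real (n choose j) / real (Suc j)"
    by (metis nonzero_mult_div_cancel_left of_nat_neq_0)
  with True show ?thesis
    by (simp add: narayana_def del: binomial_Suc_Suc of_nat_Suc)
qed (simp add: narayana_def binomial_eq_0)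

theorem theorem7p6:
  fixes k :: nat
  assumes "k \<ge> 1"
  shows "log_concave (\<lambda>n. narayana n k)"
  unfolding log_concave_def
proof (intro allI impI)
  fix n :: nat
  assume "n \<ge> 1"
  obtain j where k: "k = Suc j"
    using assms by (cases k) auto
  show "narayana (n - 1) k * narayana (n + 1) k \<le> (narayana n k)\<^sup>2"
  proof (cases "n = 1")
    case True
    then show ?thesis by (simp add: narayana_def)
  next
    case False
    obtain m where n: "n = Suc (Suc m)"
      using that[of "n - 2"] False \<open>n \<ge> 1\<close> by simp
    define b where "b i = real (i choose j)" for i
    have b: "b i * b (Suc (Suc i)) \<le> (b (Suc i))\<^sup>2" for i
      unfolding b_def using binomial_log_concave_upper[of i j]
      by (metis of_nat_le_iff of_nat_mult of_nat_power)
    have N: "narayana (Suc i) k = b (Suc i) * b i / real k" for i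
      by (simp only: k narayana_eq_binomial_product b_def)
    have "narayana (n - 1) k * narayana (n + 1) k
        = (b (Suc m) * b (Suc (Suc (Suc m)))) * (b m * b (Suc (Suc m))) / (real k)\<^sup>2"
      by (simp add: n N power2_eq_square)
    also have "\<dots> \<le> (b (Suc (Suc m)))\<^sup>2 * (b (Suc m))\<^sup>2 / (real k)\<^sup>2"
      by (intro divide_right_mono mult_mono b) (simp_all add: b_def)
    also have "\<dots> = (narayana n k)\<^sup>2"
      by (simp add: n N power_mult_distrib power_divide)
    finally show ?thesis .
  qed
qed

end
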